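(* Let $q$ be a prime power, let $C$ be an $[n,k]$ code over $\mathbb{F}_{q^2}$ with generator matrix $G = \begin{pmatrix} I_k & A \end{pmatrix}$, where $A$ is a $k \times (n-k)$ matrix, and let $x,y \in \mathbb{F}_{q^2}^{n-k}$ be nonzero vectors. Suppose that $(x,x)_h=(y,y)_h=(x,y)_h=0$. Then $C(A(x,y))$ is a Hermitian LCD code if and only if $C$ is a Hermitian LCD code.
   Context: An $[n,k]$ code over $\mathbb{F}_{q^2}$ is a $k$-dimensional subspace of $\mathbb{F}_{q^2}^n$; a generator matrix of it is a matrix whose rows form a basis of it. $I_k$ is the identity matrix of order $k$. For $a\in\mathbb{F}_{q^2}$, $\overline{a}=a^q$. The Hermitian inner product of $u,v\in\mathbb{F}_{q^2}^m$ is $(u,v)_h=\sum_{i=1}^m u_i\overline{v_i}$. The Hermitian dual code of a code $C$ of length $n$ is $C^{\perp h}=\{u\in\mathbb{F}_{q^2}^n \mid (u,v)_h=0 \text{ for all } v\in C\}$. $C$ is a Hermitian LCD code if $C\cap C^{\perp h}=\{0\}$. For a $k\times(n-k)$ matrix $A$ over $\mathbb{F}_{q^2}$ with rows $r_1,\dots,r_k$ and $x,y\in\mathbb{F}_{q^2}^{n-k}$, $A(x,y)$ denotes the $k\times(n-k)$ matrix whose $i$-th row is $r_i'=r_i+(r_i,y)_h\,x-(r_i,x)_h\,y$. $C(A(x,y))$ denotes the code with generator matrix $\begin{pmatrix} I_k & A(x,y)\end{pmatrix}$. *)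

theory Defs
  imports
    "Jordan_Normal_Form.VS_Connect"
    "HOL-Number_Theory.Prime_Powers"
begin

definition linear_code :: "nat \<Rightarrow> nat \<Rightarrow> 'a::field vec set \<Rightarrow> bool" where
  "linear_code n k C \<longleftrightarrow>
     VectorSpace.subspace class_ring C (module_vec TYPE('a) n) \<and>
     vectorspace.dim class_ring ((module_vec TYPE('a) n)\<lparr>carrier := C\<rparr>) = k"

text \<open>The rows form a basis as a family, hence \<open>distinct\<close>.\<close>

definition generator_matrix :: "nat \<Rightarrow> 'a::field mat \<Rightarrow> 'a vec set \<Rightarrow> bool" where
  "generator_matrix n G C \<longleftrightarrow>
     dim_col G = n \<and> distinct (rows G) \<and>
     vectorspace.basis class_ring ((module_vec TYPE('a) n)\<lparr>carrier := C\<rparr>) (set (rows G))"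

definition code_generated_by :: "'a::field mat \<Rightarrow> 'a vec set" where
  "code_generated_by G = vec_space.row_space (dim_col G) G"

text \<open>The block matrix \<open>(I A)\<close>; the lower blocks have no rows.\<close>

definition id_augmented :: "'a::field mat \<Rightarrow> 'a mat" where
  "id_augmented A =
     four_block_mat (1\<^sub>m (dim_row A)) A (0\<^sub>m 0 (dim_row A)) (0\<^sub>m 0 (dim_col A))"

text \<open>Over the field with \<open>q\<^sup>2\<close> elements, conjugation is \<open>a \<mapsto> a ^ q\<close>.\<close>

definition herm_prod :: "nat \<Rightarrow> 'a::field vec \<Rightarrow> 'a vec \<Rightarrow> 'a" where
  "herm_prod q u v = u \<bullet> map_vec (\<lambda>a. a ^ q) v"

definition hermitian_dual :: "nat \<Rightarrow> nat \<Rightarrow> 'a::field vec set \<Rightarrow> 'a vec set" where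
  "hermitian_dual q n C = {u \<in> carrier_vec n. \<forall>v\<in>C. herm_prod q u v = 0}"

definition hermitian_LCD :: "nat \<Rightarrow> nat \<Rightarrow> 'a::field vec set \<Rightarrow> bool" where
  "hermitian_LCD q n C \<longleftrightarrow> C \<inter> hermitian_dual q n C = {0\<^sub>v n}"

definition modified_matrix :: "nat \<Rightarrow> 'a::field mat \<Rightarrow> 'a vec \<Rightarrow> 'a vec \<Rightarrow> 'a mat" where
  "modified_matrix q A x y =
     mat\<^sub>r (dim_row A) (dim_col A)
       (\<lambda>i. row A i + herm_prod q (row A i) y \<cdot>\<^sub>v x - herm_prod q (row A i) x \<cdot>\<^sub>v y)"

lemma id_augmented_carrier:
  "A \<in> carrier_mat k m \<Longrightarrow> id_augmented A \<in> carrier_mat k (k + m)"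
  unfolding id_augmented_def by auto

lemma id_augmented_left:
  assumes "A \<in> carrier_mat k m" "i < k" "j < k"
  shows "row (id_augmented A) i $ j = (if i = j then 1 else 0)"
  using assms unfolding id_augmented_def by auto

text \<open>\<open>(I A)\<close> is indeed a generator matrix of the code it generates.\<close>

lemma generator_matrix_id_augmented:
  fixes A :: "'a::field mat"
  assumes A: "A \<in> carrier_mat k m"
  shows "generator_matrix (k + m) (id_augmented A) (code_generated_by (id_augmented A))"
proof -
  let ?G = "id_augmented A" let ?n = "k + m"
  have G: "?G \<in> carrier_mat k ?n" using A by (rule id_augmented_carrier)
  interpret vec_space "TYPE('a)" ?n .
  have rn: "length (rows ?G) = k" and ri: "\<And>i. i < k \<Longrightarrow> rows ?G ! i = row ?G i"
    using G by auto
  have d: "distinct (rows ?G)"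
    unfolding distinct_conv_nth
  proof (intro allI impI)
    fix i j assume h: "i < length (rows ?G)" "j < length (rows ?G)" "i \<noteq> j"
    show "rows ?G ! i \<noteq> rows ?G ! j"
    proof
      assume "rows ?G ! i = rows ?G ! j"
      hence "row ?G i $ i = row ?G j $ i" using h rn ri by auto
      thus False using id_augmented_left[OF A] h rn by auto
    qed
  qed
  have rc: "set (rows ?G) \<subseteq> carrier_vec ?n" using G by (metis carrier_matD(2) rows_carrier)
  have li: "\<not> lin_dep (set (rows ?G))"
  proof
    assume "lin_dep (set (rows ?G))"
    then obtain S a v where S: "finite S" "S \<subseteq> set (rows ?G)" "lincomb a S = 0\<^sub>v ?n"
      "v \<in> S" "a v \<noteq> 0" unfolding lin_dep_def by auto
    then obtain i where i: "i < k" "v = row ?G i"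
      using rn ri by (metis in_set_conv_nth subsetD)
    have "lincomb a S $ i = (\<Sum>u\<in>S. a u * u $ i)"
      using S(2) rc i by (intro lincomb_index) auto
    also have "\<dots> = (\<Sum>u\<in>S. if u = v then a v else 0)"
    proof (rule sum.cong)
      fix u assume "u \<in> S"
      then obtain j where j: "j < k" "u = row ?G j"
        using rn ri S(2) by (metis in_set_conv_nth subsetD)
      have "u = v \<longleftrightarrow> j = i"
        using d j i rn ri by (metis nth_eq_iff_index_eq)
      thus "a u * u $ i = (if u = v then a v else 0)"
        using j i id_augmented_left[OF A] by auto
    qed simp
    also have "\<dots> = a v" using S by simp
    finally show False using S i by simp
  qed
  have C: "code_generated_by ?G = span (set (rows ?G))"
    using G by (simp add: code_generated_by_def row_space_def)
  have sub: "VectorSpace.subspace class_ring (span (set (rows ?G))) V"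
    using span_is_subspace rc by simp
  hence sm: "submodule class_ring (span (set (rows ?G))) V"
    by (simp add: subspace_def)
  have incl: "set (rows ?G) \<subseteq> span (set (rows ?G))"
    using in_own_span rc by simp
  interpret W: vectorspace class_ring "vs (span (set (rows ?G)))"
    using sub by (rule subspace_is_vs)
  have "W.basis (set (rows ?G))"
    unfolding W.basis_def
    using li incl span_li_not_depend[OF incl sm] by simp
  thus ?thesis
    unfolding generator_matrix_def C using G d by simp
qed

end

theory Submission
  imports Defs "HOL-Number_Theory.Residues"
begin

text \<open>The map \<open>r \<mapsto> r + (r,y)\<^sub>h x - (r,x)\<^sub>h y\<close> preserves the Hermitian inner product
  because \<open>x\<close> and \<open>y\<close> span a totally isotropic subspace. Hence \<open>(I A)\<close> and \<open>(I A(x,y))\<close> have the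
  same Gram matrix, and for a code with linearly independent generators being Hermitian LCD is the
  non-degeneracy of the Gram matrix.\<close>

text \<open>Multiplication by a nonzero \<open>a\<close> permutes the nonzero elements; comparing
  their product before and after, and cancelling it, leaves \<open>a\<close> to the power of their
  number equal to 1. Since the field has \<open>q ^ 2\<close> elements, this makes conjugation an
  involution.\<close>

lemma power_card_UNIV_eq_self:
  fixes a :: "'a::{field,finite}"
  shows "a ^ card (UNIV :: 'a set) = a"
proof (cases "a = 0")
  case True
  then show ?thesis by (simp add: power_0_left)
next
  case False
  let ?U = "UNIV - {0::'a}"
  have inj: "inj_on ((*) a) ?U" and "(*) a ` ?U \<subseteq> ?U"
    using False by (auto simp: inj_on_def)
  then have "(*) a ` ?U = ?U"
    using endo_inj_surj[of ?U] by simp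
  then have "\<Prod>?U = (\<Prod>b\<in>?U. a * b)"
    using prod.reindex[OF inj, of "\<lambda>b. b"] by simp
  then have "a ^ card ?U = 1" by (simp add: prod.distrib)
  moreover have "card (UNIV :: 'a set) = Suc (card ?U)"
    by (rule card.remove) simp_all
  ultimately show ?thesis by (simp only: power_Suc mult_1_right)
qed

text \<open>The characteristic is a prime dividing the field size, a power of \<open>p\<close>, so
  it is \<open>p\<close>. Hence \<open>q\<close> is a power of the characteristic and the freshman's
  dream gives additivity.\<close>

lemma frobenius_comm_ring_hom:
  assumes "primepow q" and "card (UNIV :: 'a::{field,finite} set) = q ^ 2"
  shows "comm_ring_hom (\<lambda>a::'a. a ^ q)"
proof -
  obtain p e where p: "prime p" "e > 0" "q = p ^ e"
    using assms(1) by (auto simp: primepow_def)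
  have prime: "prime CHAR('a)"
    by (intro prime_CHAR_semidom finite_imp_CHAR_pos) simp
  have "CHAR('a) dvd p ^ (e * 2)"
    using CHAR_dvd_CARD[where 'a = 'a] assms(2) p by (simp add: power_mult)
  with prime have "CHAR('a) = p"
    using p(1) prime_dvd_power primes_dvd_imp_eq by blast
  with prime have "(a + b) ^ q = a ^ q + b ^ q" for a b :: 'a
    using freshmans_dream'[of q e a b] p by simp
  \<comment> \<open>Positivity excludes \<open>0 ^ 0 = 1\<close>, so that zero is mapped to
    zero.\<close>
  moreover have "q > 0" using p by (simp add: prime_gt_0_nat)
  ultimately show ?thesis
    by unfold_locales (simp_all add: power_mult_distrib power_0_left)
qed

lemma herm_prod_add_left:
  assumes "u \<in> carrier_vec m" "v \<in> carrier_vec m" "w \<in> carrier_vec m"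
  shows "herm_prod q (u + v) w = herm_prod q u w + herm_prod q v w"
  using assms by (simp add: herm_prod_def add_scalar_prod_distrib)

lemma herm_prod_minus_left:
  assumes "u \<in> carrier_vec m" "v \<in> carrier_vec m" "w \<in> carrier_vec m"
  shows "herm_prod q (u - v) w = herm_prod q u w - herm_prod q v w"
  using assms by (simp add: herm_prod_def minus_scalar_prod_distrib)

lemma herm_prod_smult_left:
  assumes "u \<in> carrier_vec m" "v \<in> carrier_vec m"
  shows "herm_prod q (c \<cdot>\<^sub>v u) v = c * herm_prod q u v"
  using assms by (simp add: herm_prod_def)

lemma herm_prod_append:
  assumes "u \<in> carrier_vec m" "u' \<in> carrier_vec m'" "v \<in> carrier_vec m" "v' \<in> carrier_vec m'"
  shows "herm_prod q (u @\<^sub>v u') (v @\<^sub>v v') = herm_prod q u v + herm_prod q u' v'"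
proof -
  have "map_vec (\<lambda>a. a ^ q) (v @\<^sub>v v') = map_vec (\<lambda>a. a ^ q) v @\<^sub>v map_vec (\<lambda>a. a ^ q) v'"
    by (rule eq_vecI) auto
  then show ?thesis
    using assms by (simp add: herm_prod_def scalar_prod_append)
qed

text \<open>Conjugating the sum termwise turns each \<open>u $ i * (v $ i) ^ q\<close> into
  \<open>(u $ i) ^ q * v $ i\<close>, because conjugation is an involutive ring
  homomorphism.\<close>

lemma herm_prod_commute:
  fixes u v :: "'a::{field,finite} vec"
  assumes hom: "comm_ring_hom (\<lambda>a::'a. a ^ q)" and card: "card (UNIV :: 'a set) = q ^ 2"
    and "u \<in> carrier_vec m" "v \<in> carrier_vec m"
  shows "herm_prod q v u = herm_prod q u v ^ q"
proof -
  interpret comm_ring_hom "\<lambda>a::'a. a ^ q" by (rule hom)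
  have conj: "(a ^ q) ^ q = a" for a :: 'a
    using power_card_UNIV_eq_self[of a] card by (simp add: power_mult power2_eq_square)
  show ?thesis
    using assms(3,4)
    by (auto simp: herm_prod_def scalar_prod_def hom_sum power_mult_distrib conj mult.commute
        intro!: sum.cong)
qed

lemma modified_matrix_herm_prod:
  fixes A :: "'a::{field,finite} mat"
  assumes hom: "comm_ring_hom (\<lambda>a::'a. a ^ q)" and card: "card (UNIV :: 'a set) = q ^ 2"
    and A: "A \<in> carrier_mat k m" and x: "x \<in> carrier_vec m" and y: "y \<in> carrier_vec m"
    and isotropic: "herm_prod q x x = 0" "herm_prod q y y = 0" "herm_prod q x y = 0"
    and ij: "i < k" "j < k"
  shows "herm_prod q (row (modified_matrix q A x y) i) (row (modified_matrix q A x y) j)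
    = herm_prod q (row A i) (row A j)"
proof -
  interpret comm_ring_hom "\<lambda>a::'a. a ^ q" by (rule hom)
  let ?h = "herm_prod q"
  define T where "T r = r + ?h r y \<cdot>\<^sub>v x - ?h r x \<cdot>\<^sub>v y" for r
  have T: "T r \<in> carrier_vec m" if "r \<in> carrier_vec m" for r
    using that x y by (simp add: T_def)
  have left: "?h (T r) s = ?h r s + ?h r y * ?h x s - ?h r x * ?h y s"
    if "r \<in> carrier_vec m" "s \<in> carrier_vec m" for r s
    using that x y
    by (simp add: T_def herm_prod_minus_left[of _ m] herm_prod_add_left[of _ m]
        herm_prod_smult_left[of _ m])
  note swap = herm_prod_commute[OF hom card, where m = m]
  have yx: "?h y x = 0"
    using swap[OF x y] isotropic by simp
  \<comment> \<open>Conjugate symmetry moves \<open>T s\<close> to the first argument, where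
    \<open>left\<close> applies.\<close>
  have right: "?h r (T s) = ?h r s + ?h s y ^ q * ?h r x - ?h s x ^ q * ?h r y"
    if r: "r \<in> carrier_vec m" and s: "s \<in> carrier_vec m" for r s
    unfolding swap[OF T[OF s] r] left[OF s r]
    by (simp add: hom_minus hom_add hom_mult swap[OF s r] swap[OF x r] swap[OF y r])
  \<comment> \<open>Isotropy reduces \<open>?h x (T s)\<close> to \<open>?h x s\<close> and
    \<open>?h y (T s)\<close> to \<open>?h y s\<close>. The four remaining correction terms cancel
    in pairs, since \<open>?h x s\<close> and \<open>?h y s\<close> are the conjugates of
    \<open>?h s x\<close> and \<open>?h s y\<close>.\<close>
  have "?h (T r) (T s) = ?h r s" if r: "r \<in> carrier_vec m" and s: "s \<in> carrier_vec m" for r s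
    using swap[OF s x] swap[OF s y]
    by (simp add: left[OF r T[OF s]] right[OF r s] right[OF x s] right[OF y s] isotropic yx)
  moreover have "row (modified_matrix q A x y) l = T (row A l)" if "l < k" for l
    using that A x y by (simp add: modified_matrix_def T_def)
  ultimately show ?thesis using A ij by simp
qed

definition herm_gram :: "nat \<Rightarrow> 'a::field mat \<Rightarrow> 'a mat" where
  "herm_gram q G = G * (map_mat (\<lambda>a. a ^ q) G)\<^sup>T"

lemma herm_gram_carrier:
  "G \<in> carrier_mat k n \<Longrightarrow> herm_gram q G \<in> carrier_mat k k"
  by (simp add: herm_gram_def)

lemma herm_gram_index:
  assumes "G \<in> carrier_mat k n" "i < k" "j < k"
  shows "herm_gram q G $$ (i, j) = herm_prod q (row G i) (row G j)"
proof -
  have "row (map_mat (\<lambda>a. a ^ q) G) j = map_vec (\<lambda>a. a ^ q) (row G j)"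
    using assms by (intro eq_vecI) auto
  then show ?thesis using assms by (simp add: herm_gram_def herm_prod_def)
qed

text \<open>The Hermitian form in coordinates: conjugation commutes with the matrix-vector product,
  and the transpose in the first argument moves across the scalar product, so the two matrices meet
  as the Gram matrix.\<close>

lemma herm_prod_transpose_mult:
  fixes G :: "'a::field mat"
  assumes hom: "comm_ring_hom (\<lambda>a::'a. a ^ q)"
    and G: "G \<in> carrier_mat k n" and a: "a \<in> carrier_vec k" and b: "b \<in> carrier_vec k"
  shows "herm_prod q (G\<^sup>T *\<^sub>v a) (G\<^sup>T *\<^sub>v b) = a \<bullet> (herm_gram q G *\<^sub>v map_vec (\<lambda>a. a ^ q) b)"
proof -
  let ?c = "\<lambda>a::'a. a ^ q"
  let ?H = "(map_mat ?c G)\<^sup>T"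
  have H: "?H \<in> carrier_mat n k" "map_vec ?c b \<in> carrier_vec k"
    and Gt: "G\<^sup>T \<in> carrier_mat n k"
    using G b by simp_all
  interpret comm_ring_hom "\<lambda>a::'a. a ^ q" by (rule hom)
  have "map_vec ?c (G\<^sup>T *\<^sub>v b) = ?H *\<^sub>v map_vec ?c b"
    unfolding map_mat_transpose by (rule mult_mat_vec_hom[OF Gt b])
  then have "herm_prod q (G\<^sup>T *\<^sub>v a) (G\<^sup>T *\<^sub>v b) = (G\<^sup>T *\<^sub>v a) \<bullet> (?H *\<^sub>v map_vec ?c b)"
    by (simp only: herm_prod_def)
  also have "\<dots> = a \<bullet> (G *\<^sub>v (?H *\<^sub>v map_vec ?c b))"
    by (rule transpose_vec_mult_scalar[OF G mult_mat_vec_carrier[OF H] a])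
  also have "G *\<^sub>v (?H *\<^sub>v map_vec ?c b) = herm_gram q G *\<^sub>v map_vec ?c b"
    unfolding herm_gram_def by (rule assoc_mult_mat_vec[OF G H, symmetric])
  finally show ?thesis .
qed

lemma code_generated_by_eq:
  fixes G :: "'a::field mat"
  assumes G: "G \<in> carrier_mat k n"
  shows "code_generated_by G = (\<lambda>a. G\<^sup>T *\<^sub>v a) ` carrier_vec k"
proof -
  interpret vec_space "TYPE('a)" n .
  show ?thesis
    using G by (auto simp: code_generated_by_def row_space_eq[OF G])
qed

text \<open>The intersection of the code with its dual is the image of the left radical of the Gram
  form; \<open>inj\<close>, the independence of the rows, makes triviality of the two equivalent.
  The right-hand side depends on \<open>G\<close> only through \<open>k\<close> and
  \<open>herm_gram q G\<close>.\<close>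

lemma hermitian_LCD_code_generated_by_iff:
  fixes G :: "'a::field mat"
  assumes hom: "comm_ring_hom (\<lambda>a::'a. a ^ q)" and G: "G \<in> carrier_mat k n"
    and inj: "\<And>a. a \<in> carrier_vec k \<Longrightarrow> G\<^sup>T *\<^sub>v a = 0\<^sub>v n \<Longrightarrow> a = 0\<^sub>v k"
  shows "hermitian_LCD q n (code_generated_by G) \<longleftrightarrow>
    (\<forall>a\<in>carrier_vec k.
      (\<forall>b\<in>carrier_vec k. a \<bullet> (herm_gram q G *\<^sub>v map_vec (\<lambda>a. a ^ q) b) = 0) \<longrightarrow> a = 0\<^sub>v k)"
    (is "_ \<longleftrightarrow> (\<forall>a\<in>carrier_vec k. ?R a \<longrightarrow> _)")
proof -
  have zero: "G\<^sup>T *\<^sub>v 0\<^sub>v k = 0\<^sub>v n" using G by (intro eq_vecI) auto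
  have dual: "G\<^sup>T *\<^sub>v a \<in> hermitian_dual q n (code_generated_by G) \<longleftrightarrow> ?R a"
    if "a \<in> carrier_vec k" for a
    using that G
    by (simp add: hermitian_dual_def code_generated_by_eq[OF G] herm_prod_transpose_mult[OF hom G])
  \<comment> \<open>The intersection has to equal the zero space, so the zero word must also be
    shown to lie in it.\<close>
  have R0: "?R (0\<^sub>v k)"
    using herm_gram_carrier[OF G, of q] by simp
  have "code_generated_by G \<inter> hermitian_dual q n (code_generated_by G)
      = (\<lambda>a. G\<^sup>T *\<^sub>v a) ` {a \<in> carrier_vec k. ?R a}"
    using dual unfolding code_generated_by_eq[OF G] by blast
  also have "\<dots> = {0\<^sub>v n} \<longleftrightarrow> (\<forall>a\<in>carrier_vec k. ?R a \<longrightarrow> a = 0\<^sub>v k)"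
  proof
    assume "(\<lambda>a. G\<^sup>T *\<^sub>v a) ` {a \<in> carrier_vec k. ?R a} = {0\<^sub>v n}"
    then show "\<forall>a\<in>carrier_vec k. ?R a \<longrightarrow> a = 0\<^sub>v k" using inj by blast
  next
    assume "\<forall>a\<in>carrier_vec k. ?R a \<longrightarrow> a = 0\<^sub>v k"
    then have "{a \<in> carrier_vec k. ?R a} = {0\<^sub>v k}" using R0 by auto
    then show "(\<lambda>a. G\<^sup>T *\<^sub>v a) ` {a \<in> carrier_vec k. ?R a} = {0\<^sub>v n}" using zero by simp
  qed
  finally show ?thesis by (simp only: hermitian_LCD_def)
qed

text \<open>The identity block makes \<open>a\<close> itself the first \<open>k\<close> entries of
  the codeword.\<close>

lemma id_augmented_transpose_mult_eq_0:
  assumes A: "A \<in> carrier_mat k m" and a: "a \<in> carrier_vec k"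
    and eq: "(id_augmented A)\<^sup>T *\<^sub>v a = 0\<^sub>v (k + m)"
  shows "a = 0\<^sub>v k"
proof (rule eq_vecI)
  fix j assume "j < dim_vec (0\<^sub>v k)"
  then have j: "j < k" by simp
  have "col (id_augmented A) j = unit_vec k j"
    using A j by (intro eq_vecI) (auto simp: id_augmented_def)
  then have "((id_augmented A)\<^sup>T *\<^sub>v a) $ j = a $ j"
    using j a id_augmented_carrier[OF A] by simp
  then show "a $ j = 0\<^sub>v k $ j" using eq j by simp
qed (use a in simp)

text \<open>The identity blocks contribute the same amount to both Gram matrices, so agreement of
  the inner products of the rows of \<open>A\<close> and \<open>B\<close> suffices.\<close>

lemma hermitian_LCD_id_augmented_cong:
  fixes A B :: "'a::field mat"
  assumes hom: "comm_ring_hom (\<lambda>a::'a. a ^ q)"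
    and A: "A \<in> carrier_mat k m" and B: "B \<in> carrier_mat k m"
    and eq: "\<And>i j. i < k \<Longrightarrow> j < k \<Longrightarrow>
      herm_prod q (row A i) (row A j) = herm_prod q (row B i) (row B j)"
  shows "hermitian_LCD q (k + m) (code_generated_by (id_augmented A)) \<longleftrightarrow>
    hermitian_LCD q (k + m) (code_generated_by (id_augmented B))"
proof -
  have row: "row (id_augmented M) i = unit_vec k i @\<^sub>v row M i"
    if "M \<in> carrier_mat k m" "i < k" for M :: "'a mat" and i
    using that by (auto simp: id_augmented_def row_four_block_mat[of _ k k _ m _ 0])
  have "herm_gram q (id_augmented A) = herm_gram q (id_augmented B)"
  proof (rule eq_matI)
    fix i j assume "i < dim_row (herm_gram q (id_augmented B))"
      "j < dim_col (herm_gram q (id_augmented B))"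
    then have ij: "i < k" "j < k"
      using herm_gram_carrier[OF id_augmented_carrier[OF B], of q] by auto
    then show "herm_gram q (id_augmented A) $$ (i, j) = herm_gram q (id_augmented B) $$ (i, j)"
      using A B eq[OF ij]
      by (simp add: herm_gram_index[OF id_augmented_carrier] row herm_prod_append[of _ k _ m])
  qed (use herm_gram_carrier[OF id_augmented_carrier[OF A], of q]
      herm_gram_carrier[OF id_augmented_carrier[OF B], of q] in auto)
  then show ?thesis
    using A B
    by (simp add: hermitian_LCD_code_generated_by_iff[OF hom id_augmented_carrier]
        id_augmented_transpose_mult_eq_0)
qed

lemma generator_matrix_imp_code_generated_by:
  fixes C :: "'a::field vec set"
  assumes "linear_code n k C" and gen: "generator_matrix n G C"
  shows "code_generated_by G = C"
proof -
  interpret vec_space "TYPE('a)" n .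
  have sub: "VectorSpace.subspace class_ring C V"
    using assms(1) by (simp add: linear_code_def)
  then have sm: "submodule class_ring C V" by (simp add: subspace_def)
  interpret W: vectorspace class_ring "vs C"
    using sub by (rule subspace_is_vs)
  have "dim_col G = n" "W.basis (set (rows G))"
    using gen by (auto simp: generator_matrix_def)
  then have "W.span (set (rows G)) = C" "set (rows G) \<subseteq> C"
    by (auto simp: W.basis_def)
  then show ?thesis
    \<comment> \<open>The basis property concerns the span formed inside \<open>C\<close>, the row
      space the span in the ambient space; they agree because \<open>C\<close> is a
      submodule.\<close>
    using span_li_not_depend(1)[OF _ sm] \<open>dim_col G = n\<close>
    by (simp add: code_generated_by_def row_space_def)
qed

theorem corollary3p3:
  fixes q n k :: nat
    and C :: "'a::{field,finite} vec set"
    and A :: "'a mat"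
    and x y :: "'a vec"
  assumes "primepow q"
    and "card (UNIV :: 'a set) = q ^ 2"
    and "linear_code n k C"
    and "A \<in> carrier_mat k (n - k)"
    and "generator_matrix n (id_augmented A) C"
    and "x \<in> carrier_vec (n - k)" and "x \<noteq> 0\<^sub>v (n - k)"
    and "y \<in> carrier_vec (n - k)" and "y \<noteq> 0\<^sub>v (n - k)"
    and "herm_prod q x x = 0" and "herm_prod q y y = 0" and "herm_prod q x y = 0"
  shows "hermitian_LCD q n (code_generated_by (id_augmented (modified_matrix q A x y)))
         \<longleftrightarrow> hermitian_LCD q n C"
proof -
  note hom = frobenius_comm_ring_hom[OF assms(1,2)]
  \<comment> \<open>Subtraction is truncated, so this says \<open>k \<le> n\<close>; it follows by
    counting the columns of the generator matrix.\<close>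
  have n: "k + (n - k) = n"
    using assms(5) id_augmented_carrier[OF assms(4)] by (simp add: generator_matrix_def)
  have "modified_matrix q A x y \<in> carrier_mat k (n - k)"
    using assms(4) by (simp add: modified_matrix_def)
  from hermitian_LCD_id_augmented_cong[OF hom this assms(4)
      modified_matrix_herm_prod[OF hom assms(2,4,6,8,10-12)]]
  show ?thesis
    by (simp only: n generator_matrix_imp_code_generated_by[OF assms(3,5)])
qed

end
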